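(* Let $\lambda$ be a partition with $r$ parts (zero parts allowed), with degree sequence $n_\lambda=(n_{\lambda,1},\dots,n_{\lambda,r})$, and let $m\ge3$ be an odd integer with $\gcd(m,\Delta(n_\lambda))=1$. Then the residues $n_{\lambda,i}\bmod m\in\{0,1,\dots,m-1\}$, $1\le i\le r$, are pairwise distinct, so they form (as a set) the degree sequence of a unique partition $\mu$ of length $r$. Furthermore $$\mathrm{He}_\lambda(x)\equiv x^{|\lambda|-|\mu|}\,\mathrm{He}_\mu(x)\pmod m,$$ i.e. corresponding coefficients of the two integer polynomials are congruent modulo $m$.
   Context: $\mathrm{He}_k(x)$ denotes the monic probabilists' Hermite polynomial of degree $k$ (solution of $y''-xy'+ky=0$). A partition $\lambda=(\lambda_1\ge\dots\ge\lambda_r\ge 0)$ may have zero parts; $|\lambda|=\sum\lambda_i$. Its degree sequence is $n_\lambda=(\lambda_r,\lambda_{r-1}+1,\dots,\lambda_1+r-1)$; conversely any set of $r$ distinct non-negative integers is the degree sequence of exactly one partition of length $r$. $\Delta(x_1,\dots,x_r)=\prod_{i<j}(x_j-x_i)$. The Wronskian Hermite polynomial is $\mathrm{He}_\lambda(x)=\mathrm{Wr}[\mathrm{He}_{n_1},\dots,\mathrm{He}_{n_r}]/\Delta(n_\lambda)$ with $n_\lambda=(n_1,\dots,n_r)$; it is monic of degree $|\lambda|$ with integer coefficients. *)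

theory Defs
  imports "Jordan_Normal_Form.Determinant" "HOL-Computational_Algebra.Polynomial"
    "HOL-Number_Theory.Cong"
begin

text \<open>Monic probabilists' Hermite polynomials, via the standard three-term recurrence
  He_0 = 1, He_1 = x, He_(k+2) = x He_(k+1) - (k+1) He_k.\<close>
fun hermite :: "nat \<Rightarrow> int poly" where
  "hermite 0 = 1"
| "hermite (Suc 0) = [:0, 1:]"
| "hermite (Suc (Suc k)) = [:0, 1:] * hermite (Suc k) - smult (int (Suc k)) (hermite k)"

definition wronskian :: "int poly list \<Rightarrow> int poly" where
  "wronskian fs = det (mat (length fs) (length fs) (\<lambda>(i, j). (pderiv ^^ i) (fs ! j)))"

definition is_partition :: "nat list \<Rightarrow> bool" where
  "is_partition lam \<longleftrightarrow> sorted_wrt (\<ge>) lam"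

definition degseq :: "nat list \<Rightarrow> nat list" where
  "degseq lam = map (\<lambda>i. lam ! (length lam - 1 - i) + i) [0..<length lam]"

definition vandermonde :: "nat list \<Rightarrow> int" where
  "vandermonde ns = (\<Prod>(i, j) \<in> {(i, j). i < j \<and> j < length ns}. int (ns ! j) - int (ns ! i))"

text \<open>Wronskian Hermite polynomial He_lam = Wr[He_n1, ..., He_nr] / Delta(n_lam)
  (an exact division in Z[x]).\<close>
definition hermite_partition :: "nat list \<Rightarrow> int poly" where
  "hermite_partition lam =
     map_poly (\<lambda>c. c div vandermonde (degseq lam)) (wronskian (map hermite (degseq lam)))"

end

(* For odd m the Appell form of He_m gives He_m = x^m (mod m), and the three-term recurrence then
   gives He_(n+m) = x^m He_n (mod m). Since x^(mq) has derivative 0 modulo m, the Wronskian of the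
   He_(n_i) is congruent to a power of x times the Wronskian of the He_(n_i mod m); the Vandermonde
   products are congruent too, and are invertible modulo m.

   To cancel them one needs that the Vandermonde product divides the Wronskian in Z[x]. View the
   expansion along the last column as a function phi of the last degree d. By the Hermite equation,
   phi(d) = A(d) He_d + B(d) He_d' with A, B in Z[x][d]. This class of functions is closed under
   d -> d + 1, and if phi(0) = A(0) = 0 then He_d' = d He_(d-1) lets one divide phi by d without
   leaving the class (up to a shift). Hence the zeros n_1 < ... < n_(r-1) < d of phi can be divided
   out one after another. *)
theory Submission
  imports Defs
begin

lemma hermite_Suc: "hermite (Suc n) = [:0, 1:] * hermite n - pderiv (hermite n)"
  and pderiv_hermite_Suc: "pderiv (hermite (Suc n)) = of_nat (Suc n) * hermite n"
proof (induction n)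
  case 0
  show "hermite (Suc 0) = [:0, 1:] * hermite 0 - pderiv (hermite 0)"
    and "pderiv (hermite (Suc 0)) = of_nat (Suc 0) * hermite 0"
    by (simp_all add: pderiv_pCons)
next
  case (Suc n)
  have rec: "hermite (Suc (Suc n)) = [:0, 1:] * hermite (Suc n) - of_nat (Suc n) * hermite n"
    by (simp add: of_nat_poly)
  show *: "hermite (Suc (Suc n)) = [:0, 1:] * hermite (Suc n) - pderiv (hermite (Suc n))"
    using rec Suc(2) by simp
  have "pderiv (hermite (Suc (Suc n))) =
      hermite (Suc n) + [:0, 1:] * pderiv (hermite (Suc n)) - of_nat (Suc n) * pderiv (hermite n)"
    unfolding rec by (simp add: pderiv_diff pderiv_mult pderiv_pCons del: hermite.simps of_nat_Suc)
  also have "\<dots> = hermite (Suc n) + of_nat (Suc n) * ([:0, 1:] * hermite n - pderiv (hermite n))"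
    unfolding Suc(2) by (simp only: algebra_simps)
  also have "\<dots> = of_nat (Suc (Suc n)) * hermite (Suc n)"
    unfolding Suc(1)[symmetric] by (simp add: algebra_simps del: hermite.simps)
  finally show "pderiv (hermite (Suc (Suc n))) = of_nat (Suc (Suc n)) * hermite (Suc n)" .
qed

subsection \<open>Hermite polynomials modulo an odd number\<close>

lemma coeff_hermite: "k \<le> n \<Longrightarrow> coeff (hermite n) k = int (n choose k) * coeff (hermite (n - k)) 0"
proof (induction k arbitrary: n)
  case (Suc k)
  then obtain l where n: "n = Suc l" by (cases n) auto
  have "int (Suc k) * coeff (hermite n) (Suc k) = coeff (pderiv (hermite n)) k"
    by (simp add: coeff_pderiv)
  also have "\<dots> = int (Suc l) * coeff (hermite l) k"
    unfolding n pderiv_hermite_Suc by (simp add: of_nat_poly)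
  also have "\<dots> = int (Suc l) * (int (l choose k) * coeff (hermite (l - k)) 0)"
    using Suc n by simp
  also have "\<dots> = int (Suc l * (l choose k)) * coeff (hermite (l - k)) 0"
    by (simp only: of_nat_mult mult.assoc)
  also have "\<dots> = int ((Suc l choose Suc k) * Suc k) * coeff (hermite (l - k)) 0"
    by (simp only: Suc_times_binomial_eq)
  also have "\<dots> = int (Suc k) * (int (Suc l choose Suc k) * coeff (hermite (l - k)) 0)"
    by (simp only: of_nat_mult mult_ac)
  finally show ?case
    using n by (simp del: of_nat_Suc)
qed simp

lemma coeff_hermite_self: "coeff (hermite n) n = 1"
  using coeff_hermite[of n n] by simp

lemma degree_hermite_le: "degree (hermite n) \<le> n"
proof (induction n rule: hermite.induct)
  case (3 n)
  have "degree ([:0, 1:] * hermite (Suc n)) \<le> Suc (Suc n)"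
    using 3(1) degree_mult_le[of "[:0, 1:]" "hermite (Suc n)"] by (simp del: mult_pCons_left)
  moreover have "degree (smult (int (Suc n)) (hermite n)) \<le> Suc (Suc n)"
    using 3(2) degree_smult_le[of "int (Suc n)" "hermite n"] by linarith
  ultimately show ?case
    unfolding hermite.simps by (rule degree_diff_le)
qed auto

lemma hermite_zero_even: "2 ^ j * fact j * coeff (hermite (2 * j)) 0 = (- 1) ^ j * fact (2 * j)"
proof (induction j)
  case (Suc j)
  have "coeff (hermite (2 * Suc j)) 0 = - int (Suc (2 * j)) * coeff (hermite (2 * j)) 0"
    by (simp add: algebra_simps)
  then have "2 ^ Suc j * fact (Suc j) * coeff (hermite (2 * Suc j)) 0 =
      - int (2 * Suc j) * int (Suc (2 * j)) * (2 ^ j * fact j * coeff (hermite (2 * j)) 0)"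
    by (simp add: algebra_simps)
  also have "\<dots> = (- 1) ^ Suc j * (int (2 * Suc j) * int (Suc (2 * j)) * fact (2 * j))"
    unfolding Suc by (simp add: algebra_simps)
  also have "int (2 * Suc j) * int (Suc (2 * j)) * fact (2 * j) = fact (2 * Suc j)"
    by (simp add: algebra_simps)
  finally show ?case .
qed simp

lemma hermite_zero_odd: "coeff (hermite (2 * j + 1)) 0 = 0"
  by (induction j) auto

lemma dvd_power_2_mult_hermite_zero:
  assumes "l \<ge> 1"
  shows "int l dvd 2 ^ l * coeff (hermite l) 0"
proof (cases "even l")
  case True
  then obtain j where l: "l = 2 * j" by blast
  with assms obtain i where j: "j = Suc i" by (cases j) auto
  have "fact j dvd (fact (2 * j - 1) :: int)"
    using j by (intro fact_dvd) auto
  then obtain t :: int where t: "fact (2 * j - 1) = fact j * t" by blast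
  have "fact (2 * j) = int l * fact (2 * j - 1)"
    using j by (simp add: l fact_reduce)
  then have "fact j * (2 ^ j * coeff (hermite l) 0) = fact j * ((- 1) ^ j * (int l * t))"
    using hermite_zero_even[of j] unfolding t l by (simp only: mult_ac)
  then have "2 ^ j * coeff (hermite l) 0 = (- 1) ^ j * (int l * t)"
    by simp
  moreover have "(2 :: int) ^ l = 2 ^ j * 2 ^ j"
    by (simp add: l mult_2 power_add)
  ultimately have "2 ^ l * coeff (hermite l) 0 = 2 ^ j * ((- 1) ^ j * (int l * t))"
    by (simp only: mult.assoc)
  then show ?thesis by simp
next
  case False
  then show ?thesis using hermite_zero_odd by (auto elim!: oddE)
qed

lemma dvd_coeff_hermite:
  assumes "odd m" "k < m"
  shows "int m dvd coeff (hermite m) k"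
proof -
  define l where "l = m - k"
  have l: "l \<ge> 1" "l \<le> m" using assms by (auto simp: l_def)
  obtain t where t: "2 ^ l * coeff (hermite l) 0 = int l * t"
    using dvd_power_2_mult_hermite_zero[OF l(1)] by blast
  have "l * (m choose l) = m * ((m - 1) choose (l - 1))"
    using times_binomial_minus1_eq[of l m] l by simp
  then have "int l * int (m choose l) = int m * int ((m - 1) choose (l - 1))"
    by (simp only: flip: of_nat_mult)
  moreover have "coeff (hermite m) k = int (m choose l) * coeff (hermite l) 0"
    using coeff_hermite[of k m] binomial_symmetric[of k m] assms by (simp add: l_def)
  then have "2 ^ l * coeff (hermite m) k = int (m choose l) * (2 ^ l * coeff (hermite l) 0)"
    by (simp only: mult.left_commute)
  then have "2 ^ l * coeff (hermite m) k = (int l * int (m choose l)) * t"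
    unfolding t by (simp only: mult_ac)
  ultimately have "int m dvd 2 ^ l * coeff (hermite m) k"
    by simp
  moreover have "coprime (int m) (2 ^ l)"
    using assms(1) by simp
  ultimately show ?thesis
    by (simp add: coprime_dvd_mult_right_iff)
qed

definition poly_cong :: "nat \<Rightarrow> int poly \<Rightarrow> int poly \<Rightarrow> bool" where
  "poly_cong m p q \<longleftrightarrow> of_nat m dvd p - q"

lemma poly_cong_iff: "poly_cong m p q \<longleftrightarrow> (\<forall>k. [coeff p k = coeff q k] (mod int m))"
proof -
  have *: "(of_nat m :: int poly) = [:int m:]" by (simp add: of_nat_poly)
  show ?thesis
    unfolding poly_cong_def * const_poly_dvd_iff by (simp add: cong_iff_dvd_diff)
qed

lemma poly_cong_refl [simp]: "poly_cong m p p"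
  by (simp add: poly_cong_def)

lemma poly_cong_trans [trans]: "poly_cong m p q \<Longrightarrow> poly_cong m q r \<Longrightarrow> poly_cong m p r"
  unfolding poly_cong_def by (drule (1) dvd_add) simp

lemma poly_cong_add: "poly_cong m p q \<Longrightarrow> poly_cong m p' q' \<Longrightarrow> poly_cong m (p + p') (q + q')"
  unfolding poly_cong_def by (drule (1) dvd_add) (simp add: algebra_simps)

lemma poly_cong_diff: "poly_cong m p q \<Longrightarrow> poly_cong m p' q' \<Longrightarrow> poly_cong m (p - p') (q - q')"
  unfolding poly_cong_def by (drule (1) dvd_diff) (simp add: algebra_simps)

lemma poly_cong_mult:
  assumes "poly_cong m p q" "poly_cong m p' q'"
  shows "poly_cong m (p * p') (q * q')"
proof -
  have "p * p' - q * q' = (p - q) * p' + q * (p' - q')"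
    by (simp add: algebra_simps)
  then show ?thesis
    using assms unfolding poly_cong_def by (metis dvd_add dvd_mult dvd_mult2)
qed

lemma poly_cong_sum: "(\<And>i. i \<in> I \<Longrightarrow> poly_cong m (f i) (g i)) \<Longrightarrow> poly_cong m (sum f I) (sum g I)"
  by (induction I rule: infinite_finite_induct) (auto intro: poly_cong_add)

lemma poly_cong_prod: "(\<And>i. i \<in> I \<Longrightarrow> poly_cong m (f i) (g i)) \<Longrightarrow> poly_cong m (prod f I) (prod g I)"
  by (induction I rule: infinite_finite_induct) (auto intro: poly_cong_mult)

lemma poly_cong_pderiv: "poly_cong m p q \<Longrightarrow> poly_cong m (pderiv p) (pderiv q)"
  unfolding poly_cong_def
  by (auto simp: pderiv_mult simp flip: pderiv_diff elim!: dvdE)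

lemma poly_cong_higher_pderiv: "poly_cong m p q \<Longrightarrow> poly_cong m ((pderiv ^^ i) p) ((pderiv ^^ i) q)"
  by (induction i) (auto intro: poly_cong_pderiv)

lemma poly_cong_det:
  assumes "\<And>i j. i < r \<Longrightarrow> j < r \<Longrightarrow> poly_cong m (f i j) (g i j)"
  shows "poly_cong m (det (mat r r (\<lambda>(i, j). f i j))) (det (mat r r (\<lambda>(i, j). g i j)))"
proof -
  have *: "p i < r" if "p permutes {0..<r}" "i < r" for p i
    using that permutes_in_image by fastforce
  show ?thesis
    by (subst (1 2) det_def'[of _ r])
      (auto intro!: poly_cong_sum poly_cong_mult poly_cong_prod simp: * assms)
qed

lemma hermite_cong_monom:
  assumes "odd m"
  shows "poly_cong m (hermite m) (monom 1 m)"
  unfolding poly_cong_iff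
proof
  fix k
  consider "k < m" | "k = m" | "k > m" by linarith
  then show "[coeff (hermite m) k = coeff (monom 1 m) k] (mod int m)"
  proof cases
    case 1
    then show ?thesis using dvd_coeff_hermite[OF assms] by (simp add: cong_0_iff)
  next
    case 2
    then show ?thesis by (simp add: coeff_hermite_self)
  next
    case 3
    then show ?thesis using degree_hermite_le[of m] by (simp add: coeff_eq_0)
  qed
qed

lemma hermite_add_cong:
  assumes "odd m"
  shows "poly_cong m (hermite (n + m)) (monom 1 m * hermite n)"
proof (induction n rule: hermite.induct)
  case 1
  then show ?case using hermite_cong_monom[OF assms] by simp
next
  case 2
  obtain l where m: "m = Suc l" using assms by (cases m) auto
  have "poly_cong m (hermite (Suc m)) ([:0, 1:] * hermite m)"
    unfolding poly_cong_def m by (subst hermite_Suc) (simp add: pderiv_hermite_Suc del: of_nat_Suc hermite.simps)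
  also have "poly_cong m ([:0, 1:] * hermite m) ([:0, 1:] * monom 1 m)"
    by (intro poly_cong_mult hermite_cong_monom assms poly_cong_refl)
  finally show ?case by (simp add: mult.commute)
next
  case (3 k)
  have "poly_cong m (of_nat (Suc k + m)) (of_nat (Suc k))"
    by (simp add: poly_cong_def)
  then have "poly_cong m ([:0, 1:] * hermite (Suc k + m) - of_nat (Suc k + m) * hermite (k + m))
      ([:0, 1:] * (monom 1 m * hermite (Suc k)) - of_nat (Suc k) * (monom 1 m * hermite k))"
    by (intro poly_cong_diff poly_cong_mult 3 poly_cong_refl)
  moreover have "hermite (Suc (Suc k) + m) =
      [:0, 1:] * hermite (Suc k + m) - of_nat (Suc k + m) * hermite (k + m)"
    by (simp add: of_nat_poly)
  moreover have "monom 1 m * hermite (Suc (Suc k)) =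
      [:0, 1:] * (monom 1 m * hermite (Suc k)) - of_nat (Suc k) * (monom 1 m * hermite k)"
    unfolding hermite.simps by (simp add: of_nat_poly algebra_simps)
  ultimately show ?case by simp
qed

lemma hermite_mod_cong:
  assumes "odd m"
  shows "poly_cong m (hermite n) (monom 1 (m * (n div m)) * hermite (n mod m))"
proof -
  have "poly_cong m (hermite (s + m * q)) (monom 1 (m * q) * hermite s)" for q s
  proof (induction q)
    case (Suc q)
    have "poly_cong m (hermite ((s + m * q) + m)) (monom 1 m * hermite (s + m * q))"
      by (rule hermite_add_cong[OF assms])
    also have "poly_cong m \<dots> (monom 1 m * (monom 1 (m * q) * hermite s))"
      by (intro poly_cong_mult Suc poly_cong_refl)
    finally show ?case by (simp add: algebra_simps mult_monom flip: mult.assoc)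
  qed simp
  from this[of "n mod m" "n div m"] show ?thesis by simp
qed

lemma higher_pderiv_monom_mult_cong:
  "poly_cong m ((pderiv ^^ i) (monom 1 (m * q) * p)) (monom 1 (m * q) * (pderiv ^^ i) p)"
proof (induction i)
  case (Suc i)
  have "poly_cong m ((pderiv ^^ Suc i) (monom 1 (m * q) * p)) (pderiv (monom 1 (m * q) * (pderiv ^^ i) p))"
    using poly_cong_pderiv[OF Suc] by simp
  also have "poly_cong m \<dots> (monom 1 (m * q) * (pderiv ^^ Suc i) p)"
  proof -
    have "pderiv (monom 1 (m * q)) = of_nat m * monom (int q) (m * q - 1)"
      by (simp add: pderiv_monom of_nat_poly smult_monom)
    then show ?thesis
      by (simp add: poly_cong_def pderiv_mult)
  qed
  finally show ?case .
qed simp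

subsection \<open>Divisibility of the Wronskian by the Vandermonde product\<close>

lemma hermite_ODE:
  "pderiv (pderiv (hermite n)) = [:0, 1:] * pderiv (hermite n) - of_nat n * hermite n"
proof -
  have "pderiv (hermite (Suc n)) = hermite n + [:0, 1:] * pderiv (hermite n) - pderiv (pderiv (hermite n))"
    unfolding hermite_Suc by (simp add: pderiv_diff pderiv_mult pderiv_pCons)
  then show ?thesis
    unfolding pderiv_hermite_Suc by (simp add: algebra_simps)
qed

definition hermite_span :: "(nat \<Rightarrow> int poly) set" where
  "hermite_span = {\<phi>. \<exists>A B. \<forall>d. \<phi> d = poly A (of_nat d) * hermite d + poly B (of_nat d) * pderiv (hermite d)}"

lemma hermite_spanI:
  assumes "\<And>d. \<phi> d = poly A (of_nat d) * hermite d + poly B (of_nat d) * pderiv (hermite d)"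
  shows "\<phi> \<in> hermite_span"
  using assms unfolding hermite_span_def by blast

lemma hermite_spanE:
  assumes "\<phi> \<in> hermite_span"
  obtains A B where "\<And>d. \<phi> d = poly A (of_nat d) * hermite d + poly B (of_nat d) * pderiv (hermite d)"
  using assms unfolding hermite_span_def by blast

lemma hermite_span_add:
  assumes "\<phi> \<in> hermite_span" "\<psi> \<in> hermite_span"
  shows "(\<lambda>d. \<phi> d + \<psi> d) \<in> hermite_span"
proof -
  from assms obtain A B A' B' where
    "\<And>d. \<phi> d = poly A (of_nat d) * hermite d + poly B (of_nat d) * pderiv (hermite d)"
    "\<And>d. \<psi> d = poly A' (of_nat d) * hermite d + poly B' (of_nat d) * pderiv (hermite d)"
    by (elim hermite_spanE) blast
  then show ?thesis
    by (intro hermite_spanI[of _ "A + A'" "B + B'"]) (simp add: algebra_simps)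
qed

lemma hermite_span_cmult:
  assumes "\<phi> \<in> hermite_span"
  shows "(\<lambda>d. c * \<phi> d) \<in> hermite_span"
proof -
  from assms obtain A B where
    "\<And>d. \<phi> d = poly A (of_nat d) * hermite d + poly B (of_nat d) * pderiv (hermite d)"
    by (elim hermite_spanE) blast
  then show ?thesis
    by (intro hermite_spanI[of _ "smult c A" "smult c B"]) (simp add: algebra_simps)
qed

lemma hermite_span_sum:
  assumes "\<And>i. i \<in> I \<Longrightarrow> \<phi> i \<in> hermite_span"
  shows "(\<lambda>d. \<Sum>i\<in>I. \<phi> i d) \<in> hermite_span"
  using assms
proof (induction I rule: infinite_finite_induct)
  case (insert i I)
  then show ?case by (simp add: hermite_span_add)
qed (auto intro: hermite_spanI[of _ 0 0])

lemma pderiv_poly_of_nat: "pderiv (poly A (of_nat d)) = poly (map_poly pderiv A) (of_nat d)"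
  by (induction A) (simp_all add: map_poly_pCons pderiv_add pderiv_mult)

lemma hermite_span_pderiv:
  assumes "\<phi> \<in> hermite_span"
  shows "(\<lambda>d. pderiv (\<phi> d)) \<in> hermite_span"
proof -
  from assms obtain A B where
    \<phi>: "\<And>d. \<phi> d = poly A (of_nat d) * hermite d + poly B (of_nat d) * pderiv (hermite d)"
    by (elim hermite_spanE) blast
  show ?thesis
  proof (rule hermite_spanI)
    show "pderiv (\<phi> d) =
      poly (map_poly pderiv A - [:0, 1:] * B) (of_nat d) * hermite d +
      poly (A + map_poly pderiv B + smult [:0, 1:] B) (of_nat d) * pderiv (hermite d)" for d
      unfolding \<phi> pderiv_add pderiv_mult hermite_ODE pderiv_poly_of_nat poly_add poly_diff
        poly_mult poly_smult poly_pCons poly_0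
      by (simp only: algebra_simps mult_zero_right add_0_left mult_1)
  qed
qed

lemma higher_pderiv_hermite_in_span: "(\<lambda>d. (pderiv ^^ i) (hermite d)) \<in> hermite_span"
proof (induction i)
  case 0
  show ?case by (rule hermite_spanI[of _ 1 0]) simp
next
  case (Suc i)
  then show ?case by (simp add: hermite_span_pderiv)
qed

lemma poly_of_nat_Suc: "poly A (of_nat (Suc d)) = poly (A \<circ>\<^sub>p [:1, 1:]) (of_nat d)"
  by (simp add: poly_pcompose)

lemma hermite_span_shift:
  assumes "\<phi> \<in> hermite_span"
  shows "(\<lambda>d. \<phi> (Suc d)) \<in> hermite_span"
proof -
  from assms obtain A B where
    \<phi>: "\<And>d. \<phi> d = poly A (of_nat d) * hermite d + poly B (of_nat d) * pderiv (hermite d)"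
    by (elim hermite_spanE) blast
  show ?thesis
  proof (rule hermite_spanI)
    show "\<phi> (Suc d) =
      poly (smult [:0, 1:] (A \<circ>\<^sub>p [:1, 1:]) + [:1, 1:] * (B \<circ>\<^sub>p [:1, 1:])) (of_nat d) * hermite d +
      poly (- (A \<circ>\<^sub>p [:1, 1:])) (of_nat d) * pderiv (hermite d)" for d
      unfolding \<phi> pderiv_hermite_Suc poly_of_nat_Suc unfolding hermite_Suc poly_add poly_minus
        poly_mult poly_smult poly_pCons poly_0 of_nat_Suc
      by (simp only: algebra_simps mult_zero_right add_0_left mult_1)
  qed
qed

lemma hermite_span_divide:
  assumes "\<phi> \<in> hermite_span" "\<phi> 0 = 0"
  obtains \<psi> where "\<psi> \<in> hermite_span" "\<And>d. \<phi> (Suc d) = of_nat (Suc d) * \<psi> d"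
proof -
  from assms(1) obtain A B where
    \<phi>: "\<And>d. \<phi> d = poly A (of_nat d) * hermite d + poly B (of_nat d) * pderiv (hermite d)"
    by (elim hermite_spanE) blast
  obtain a A' where A: "A = pCons a A'" by (cases A)
  have a: "a = 0" using assms(2) \<phi>[of 0] A by simp
  define \<psi> where
    "\<psi> d = poly A' (of_nat (Suc d)) * hermite (Suc d) + poly B (of_nat (Suc d)) * hermite d" for d
  have "\<psi> \<in> hermite_span"
  proof (rule hermite_spanI)
    show "\<psi> d =
      poly (smult [:0, 1:] (A' \<circ>\<^sub>p [:1, 1:]) + (B \<circ>\<^sub>p [:1, 1:])) (of_nat d) * hermite d +
      poly (- (A' \<circ>\<^sub>p [:1, 1:])) (of_nat d) * pderiv (hermite d)" for d
      unfolding \<psi>_def poly_of_nat_Suc hermite_Suc poly_add poly_minus poly_smult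
      by (simp only: algebra_simps)
  qed
  moreover have "\<phi> (Suc d) = of_nat (Suc d) * \<psi> d" for d
    unfolding \<phi> A a \<psi>_def pderiv_hermite_Suc poly_pCons by (simp only: algebra_simps add_0_left)
  ultimately show thesis using that by blast
qed

lemma hermite_span_roots_dvd:
  assumes "\<phi> \<in> hermite_span" "S \<subseteq> {..<d}" "\<And>s. s \<in> S \<Longrightarrow> \<phi> s = 0"
  shows "(\<Prod>s\<in>S. of_nat (d - s)) dvd \<phi> d"
  using assms
proof (induction d arbitrary: \<phi> S)
  case (Suc d)
  define S' where "S' = {s. Suc s \<in> S}"
  have S': "S' \<subseteq> {..<d}" using Suc.prems(2) by (auto simp: S'_def)
  then have fin: "finite S'" by (rule finite_subset) simp
  have S: "S - {0} = Suc ` S'"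
    unfolding S'_def by (auto simp: image_iff) (metis not0_implies_Suc)
  have prod: "(\<Prod>s\<in>S - {0}. of_nat (Suc d - s)) = (\<Prod>s\<in>S'. of_nat (d - s) :: int poly)"
    unfolding S by (simp add: prod.reindex)
  show ?case
  proof (cases "0 \<in> S")
    case True
    then obtain \<psi> where \<psi>: "\<psi> \<in> hermite_span" "\<And>d. \<phi> (Suc d) = of_nat (Suc d) * \<psi> d"
      using hermite_span_divide Suc.prems(1,3) by blast
    have "\<psi> s = 0" if "s \<in> S'" for s
    proof -
      have "of_nat (Suc s) * \<psi> s = 0"
        using Suc.prems(3)[of "Suc s"] that \<psi>(2) by (simp add: S'_def)
      moreover have "(of_nat (Suc s) :: int poly) \<noteq> 0" by (rule of_nat_neq_0)
      ultimately show ?thesis by (simp del: of_nat_Suc)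
    qed
    then have "(\<Prod>s\<in>S'. of_nat (d - s)) dvd \<psi> d"
      using Suc.IH \<psi>(1) S' by blast
    moreover have "finite S" using Suc.prems(2) by (rule finite_subset) simp
    then have "(\<Prod>s\<in>S. of_nat (Suc d - s)) = of_nat (Suc d) * (\<Prod>s\<in>S'. of_nat (d - s) :: int poly)"
      using True by (simp add: prod.remove[of S 0] prod del: of_nat_Suc)
    ultimately show ?thesis
      unfolding \<psi>(2) by (simp add: mult_dvd_mono del: of_nat_Suc)
  next
    case False
    have "(\<Prod>s\<in>S'. of_nat (d - s)) dvd \<phi> (Suc d)"
      using Suc.IH[of "\<lambda>d. \<phi> (Suc d)" S'] hermite_span_shift[OF Suc.prems(1)] S' Suc.prems(3)
      by (auto simp: S'_def)
    then show ?thesis using False prod by simp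
  qed
qed simp

definition vandermonde_fun :: "nat \<Rightarrow> (nat \<Rightarrow> int) \<Rightarrow> int" where
  "vandermonde_fun r f = (\<Prod>j<r. \<Prod>i<j. f j - f i)"

lemma vandermonde_fun_Suc: "vandermonde_fun (Suc r) f = vandermonde_fun r f * (\<Prod>i<r. f r - f i)"
  by (simp add: vandermonde_fun_def)

lemma vandermonde_conv_fun: "vandermonde ns = vandermonde_fun (length ns) (\<lambda>i. int (ns ! i))"
proof -
  have "vandermonde_fun (length ns) (\<lambda>i. int (ns ! i)) =
      (\<Prod>(j, i)\<in>(SIGMA j:{..<length ns}. {..<j}). int (ns ! j) - int (ns ! i))"
    unfolding vandermonde_fun_def by (rule prod.Sigma) auto
  also have "\<dots> = vandermonde ns"
    unfolding vandermonde_def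
    by (rule prod.reindex_bij_witness[of _ "\<lambda>(i, j). (j, i)" "\<lambda>(j, i). (i, j)"]) auto
  finally show ?thesis ..
qed

lemma det_expand_last_column:
  fixes f :: "nat \<Rightarrow> nat \<Rightarrow> 'a::comm_ring_1"
  shows "det (mat (Suc r) (Suc r) (\<lambda>(i, j). f i j)) =
    (\<Sum>i<Suc r. f i r * ((- 1) ^ (i + r) *
      det (mat r r (\<lambda>(i', j). f (if i' < i then i' else Suc i') j))))"
proof -
  have "mat_delete (mat (Suc r) (Suc r) (\<lambda>(i, j). f i j)) i r =
      mat r r (\<lambda>(i', j). f (if i' < i then i' else Suc i') j)" for i
    unfolding mat_delete_def by (rule eq_matI) auto
  then show ?thesis
    by (subst laplace_expansion_column[of _ "Suc r" r]) (simp_all add: cofactor_def)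
qed

lemma vandermonde_fun_dvd_det:
  assumes "\<And>i j. i < j \<Longrightarrow> j < r \<Longrightarrow> n i < n j"
  shows "of_int (vandermonde_fun r (\<lambda>i. int (n i))) dvd
    det (mat r r (\<lambda>(i, j). (pderiv ^^ \<rho> i) (hermite (n j))))"
  using assms
proof (induction r arbitrary: \<rho>)
  case 0
  then show ?case by (simp add: vandermonde_fun_def)
next
  case (Suc r)
  define V where "V = (of_int (vandermonde_fun r (\<lambda>i. int (n i))) :: int poly)"
  define M where "M i = det (mat r r (\<lambda>(i', j).
      (pderiv ^^ \<rho> (if i' < i then i' else Suc i')) (hermite (n j))))" for i
  have "V dvd M i" for i
    unfolding V_def M_def by (rule Suc.IH) (use Suc.prems in auto)
  then obtain c where c: "\<And>i. M i = V * c i"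
    unfolding dvd_def by metis
  define \<phi> where "\<phi> d = (\<Sum>i<Suc r. (c i * (- 1) ^ (i + r)) * (pderiv ^^ \<rho> i) (hermite d))" for d
  have "V \<noteq> 0"
    using Suc.prems unfolding V_def vandermonde_fun_def by (force simp: prod_zero_iff)
  have det: "det (mat (Suc r) (Suc r) (\<lambda>(i, j). (pderiv ^^ \<rho> i) (hermite ((n(r := d)) j)))) = V * \<phi> d" for d
  proof -
    have "mat r r (\<lambda>(i', j). (pderiv ^^ \<rho> (if i' < i then i' else Suc i')) (hermite ((n(r := d)) j))) =
        mat r r (\<lambda>(i', j). (pderiv ^^ \<rho> (if i' < i then i' else Suc i')) (hermite (n j)))" for i
      by (rule eq_matI) auto
    then show ?thesis
      unfolding det_expand_last_column \<phi>_def sum_distrib_left M_def[symmetric]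
      by (intro sum.cong) (simp_all add: c M_def[symmetric] mult_ac)
  qed
  have "\<phi> \<in> hermite_span"
    unfolding \<phi>_def by (intro hermite_span_sum hermite_span_cmult higher_pderiv_hermite_in_span)
  moreover have "\<phi> s = 0" if s: "s \<in> n ` {..<r}" for s
  proof -
    from s obtain j where j: "j < r" "s = n j" by blast
    have "det (mat (Suc r) (Suc r) (\<lambda>(i, k). (pderiv ^^ \<rho> i) (hermite ((n(r := s)) k)))) = 0"
      by (rule det_identical_columns[of _ "Suc r" j r]) (use j in \<open>auto intro!: eq_vecI\<close>)
    then show ?thesis using det \<open>V \<noteq> 0\<close> by simp
  qed
  moreover have "n ` {..<r} \<subseteq> {..<n r}"
    using Suc.prems by auto
  ultimately have "(\<Prod>s\<in>n ` {..<r}. of_nat (n r - s)) dvd \<phi> (n r)"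
    by (intro hermite_span_roots_dvd)
  moreover have "inj_on n {..<r}"
    using Suc.prems by (intro linorder_inj_onI) (auto, metis less_Suc_eq nat_neq_iff)
  ultimately have "(\<Prod>i<r. of_nat (n r - n i)) dvd \<phi> (n r)"
    by (simp add: prod.reindex)
  moreover have "(\<Prod>i<r. of_nat (n r - n i)) = (of_int (\<Prod>i<r. int (n r) - int (n i)) :: int poly)"
    unfolding of_int_prod using Suc.prems by (intro prod.cong) (auto simp: of_nat_diff less_imp_le)
  ultimately have "of_int (vandermonde_fun (Suc r) (\<lambda>i. int (n i))) dvd V * \<phi> (n r)"
    unfolding vandermonde_fun_Suc by (simp add: V_def mult_dvd_mono del: of_int_prod)
  then show ?case
    using det[of "n r"] by simp
qed

subsection \<open>Permuting and scaling columns\<close>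

lemma det_permute_columns:
  fixes f :: "nat \<Rightarrow> nat \<Rightarrow> 'a::comm_ring_1"
  assumes "p permutes {0..<r}"
  shows "det (mat r r (\<lambda>(i, j). f i (p j))) = signof p * det (mat r r (\<lambda>(i, j). f i j))"
proof -
  let ?B = "mat r r (\<lambda>(i, j). f j i)"
  have p: "p i < r" if "i < r" for i
    using that permutes_in_image[OF assms] by fastforce
  have "det (mat r r (\<lambda>(i, j). f i (p j))) = det (mat r r (\<lambda>(i, j). f j (p i)))"
    by (subst det_transpose[of _ r, symmetric]) (auto intro!: arg_cong[of _ _ det] eq_matI)
  also have "mat r r (\<lambda>(i, j). f j (p i)) = mat r r (\<lambda>(i, j). ?B $$ (p i, j))"
    by (rule eq_matI) (auto simp: p)
  also have "det \<dots> = signof p * det ?B"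
    by (rule det_permute_rows) (use assms in auto)
  also have "det ?B = det (mat r r (\<lambda>(i, j). f i j))"
    by (subst det_transpose[of _ r, symmetric]) (auto intro!: arg_cong[of _ _ det] eq_matI)
  finally show ?thesis .
qed

lemma det_scale_columns:
  fixes f :: "nat \<Rightarrow> nat \<Rightarrow> 'a::comm_ring_1"
  shows "det (mat r r (\<lambda>(i, j). c j * f i j)) = (\<Prod>j<r. c j) * det (mat r r (\<lambda>(i, j). f i j))"
proof -
  have p: "p i < r" if "p permutes {0..<r}" "i < r" for p i
    using that permutes_in_image by fastforce
  show ?thesis
    by (subst (1 2) det_col[of _ r])
      (auto simp: p prod.distrib sum_distrib_left mult_ac intro!: sum.cong)
qed

lemma det_vandermonde:
  assumes "inj_on f {..<r}"
  shows "det (mat r r (\<lambda>(i, j). f j ^ i)) = vandermonde_fun r f"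
  using assms
proof (induction r)
  case 0
  then show ?case by (simp add: vandermonde_fun_def)
next
  case (Suc r)
  define M where "M i = det (mat r r (\<lambda>(i', j). f j ^ (if i' < i then i' else Suc i')))" for i
  define P where "P = (\<Sum>i<Suc r. monom ((- 1) ^ (i + r) * M i) i)"
  have P: "poly P y = det (mat (Suc r) (Suc r) (\<lambda>(i, j). (f(r := y)) j ^ i))" for y
  proof -
    have "mat r r (\<lambda>(i', j). (f(r := y)) j ^ (if i' < i then i' else Suc i')) =
        mat r r (\<lambda>(i', j). f j ^ (if i' < i then i' else Suc i'))" for i
      by (rule eq_matI) auto
    then show ?thesis
      unfolding det_expand_last_column P_def poly_sum poly_monom M_def
      by (intro sum.cong) (simp_all add: mult_ac)
  qed
  have "mat r r (\<lambda>(i', j). f j ^ (if i' < r then i' else Suc i')) = mat r r (\<lambda>(i, j). f j ^ i)"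
    by (rule eq_matI) auto
  moreover have inj: "inj_on f {..<r}"
    using Suc.prems by (rule inj_on_subset) auto
  ultimately have "M r = vandermonde_fun r f"
    unfolding M_def using Suc.IH by simp
  then have lead: "coeff P r = vandermonde_fun r f"
    by (simp add: P_def coeff_sum flip: mult_2)
  define Q where "Q = smult (vandermonde_fun r f) (\<Prod>j<r. [:- f j, 1:])"
  have deg: "degree (\<Prod>j<r. [:- f j, 1:]) = r"
    by (subst degree_prod_eq_sum_degree) auto
  have "lead_coeff (\<Prod>j<r. [:- f j, 1:]) = 1"
    by (subst lead_coeff_prod) simp
  then have "coeff Q r = vandermonde_fun r f"
    unfolding Q_def using deg by simp
  moreover have "degree Q \<le> r"
    unfolding Q_def using deg degree_smult_le by metis
  moreover have "degree P \<le> r"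
    unfolding P_def by (intro degree_sum_le) (auto intro: order_trans[OF degree_monom_le])
  moreover have "poly P z = poly Q z" if z: "z \<in> f ` {..<r}" for z
  proof -
    from z obtain j where j: "j < r" "z = f j" by blast
    have "poly P z = 0"
      unfolding P by (rule det_identical_columns[of _ "Suc r" j r]) (use j in \<open>auto intro!: eq_vecI\<close>)
    moreover have "poly Q z = 0"
      unfolding Q_def using j by (force simp: poly_prod prod_zero_iff)
    ultimately show ?thesis by simp
  qed
  ultimately have "P = Q"
    using lead inj by (intro poly_eqI_degree_lead_coeff[of P r Q "f ` {..<r}"]) (auto simp: card_image)
  then have "poly P (f r) = vandermonde_fun (Suc r) f"
    by (simp add: Q_def poly_prod vandermonde_fun_Suc)
  then show ?case unfolding P by simp
qed

lemma wronskian_hermite: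
  "wronskian (map hermite ns) =
    det (mat (length ns) (length ns) (\<lambda>(i, j). (pderiv ^^ i) (hermite (ns ! j))))"
  unfolding wronskian_def by (rule arg_cong[of _ _ det], rule eq_matI) auto

lemma vandermonde_det:
  assumes "distinct ns"
  shows "vandermonde ns = det (mat (length ns) (length ns) (\<lambda>(i, j). int (ns ! j) ^ i))"
  unfolding vandermonde_conv_fun
  by (rule det_vandermonde[symmetric]) (use assms in \<open>auto simp: inj_on_def nth_eq_iff_index_eq\<close>)

lemma wronskian_vandermonde_permute:
  assumes "mset ns = mset ms" "distinct ns"
  obtains e :: int where "vandermonde ns = e * vandermonde ms"
    and "wronskian (map hermite ns) = of_int e * wronskian (map hermite ms)"
proof -
  obtain p where p: "p permutes {..<length ms}" "permute_list p ms = ns"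
    using mset_eq_permutation[OF assms(1)] by blast
  have p': "p permutes {0..<length ms}" using p(1) by (simp add: lessThan_atLeast0)
  have ns: "length ns = length ms" "\<And>j. j < length ms \<Longrightarrow> ns ! j = ms ! p j"
    using p by (auto simp: permute_list_nth)
  have ms: "distinct ms" using assms by (metis mset_eq_imp_distinct_iff)
  have "mat (length ns) (length ns) (\<lambda>(i, j). int (ns ! j) ^ i) =
      mat (length ms) (length ms) (\<lambda>(i, j). int (ms ! p j) ^ i)"
    by (rule eq_matI) (auto simp: ns)
  then have 1: "vandermonde ns = signof p * vandermonde ms"
    using det_permute_columns[OF p', of "\<lambda>i j. int (ms ! j) ^ i"]
    by (simp add: vandermonde_det assms ms)
  have "mat (length ns) (length ns) (\<lambda>(i, j). (pderiv ^^ i) (hermite (ns ! j))) =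
      mat (length ms) (length ms) (\<lambda>(i, j). (pderiv ^^ i) (hermite (ms ! p j)))"
    by (rule eq_matI) (auto simp: ns)
  then have 2: "wronskian (map hermite ns) = of_int (signof p) * wronskian (map hermite ms)"
    using det_permute_columns[OF p', of "\<lambda>i j. (pderiv ^^ i) (hermite (ms ! j))"]
    by (simp add: wronskian_hermite)
  from 1 2 show thesis by (rule that)
qed

lemma prod_monom_1: "(\<Prod>i\<in>I. monom 1 (c i)) = (monom 1 (\<Sum>i\<in>I. c i) :: 'a::comm_semiring_1 poly)"
  by (induction I rule: infinite_finite_induct) (simp_all add: mult_monom)

lemma wronskian_hermite_mod_cong:
  assumes "odd m"
  shows "poly_cong m (wronskian (map hermite ns))
    (monom 1 (\<Sum>n\<leftarrow>ns. m * (n div m)) * wronskian (map hermite (map (\<lambda>n. n mod m) ns)))"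
proof -
  let ?r = "length ns"
  have "poly_cong m ((pderiv ^^ i) (hermite n)) (monom 1 (m * (n div m)) * (pderiv ^^ i) (hermite (n mod m)))" for i n
    using poly_cong_higher_pderiv[OF hermite_mod_cong[OF assms]] higher_pderiv_monom_mult_cong
    by (rule poly_cong_trans)
  then have "poly_cong m (wronskian (map hermite ns)) (det (mat ?r ?r (\<lambda>(i, j).
      monom 1 (m * (ns ! j div m)) * (pderiv ^^ i) (hermite (ns ! j mod m)))))"
    unfolding wronskian_hermite by (intro poly_cong_det)
  also have "det (mat ?r ?r (\<lambda>(i, j).
      monom 1 (m * (ns ! j div m)) * (pderiv ^^ i) (hermite (ns ! j mod m)))) =
      (\<Prod>j<?r. monom 1 (m * (ns ! j div m))) *
      det (mat ?r ?r (\<lambda>(i, j). (pderiv ^^ i) (hermite (ns ! j mod m))))"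
    by (rule det_scale_columns)
  also have "(\<Prod>j<?r. monom 1 (m * (ns ! j div m))) = (monom 1 (\<Sum>j<?r. m * (ns ! j div m)) :: int poly)"
    by (rule prod_monom_1)
  also have "(\<Sum>j<?r. m * (ns ! j div m)) = (\<Sum>n\<leftarrow>ns. m * (n div m))"
    by (simp add: sum_list_sum_nth lessThan_atLeast0)
  also have "det (mat ?r ?r (\<lambda>(i, j). (pderiv ^^ i) (hermite (ns ! j mod m)))) =
      wronskian (map hermite (map (\<lambda>n. n mod m) ns))"
    unfolding wronskian_hermite by (simp, rule arg_cong[of _ _ det], rule eq_matI) auto
  finally show ?thesis .
qed

lemma vandermonde_mod_cong: "[vandermonde ns = vandermonde (map (\<lambda>n. n mod m) ns)] (mod int m)"
  unfolding vandermonde_conv_fun vandermonde_fun_def length_map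
  by (intro cong_prod cong_diff) (simp_all add: cong_def zmod_int)

lemma diff_dvd_vandermonde:
  assumes "i < j" "j < length ns"
  shows "int (ns ! j) - int (ns ! i) dvd vandermonde ns"
proof -
  have "finite {(i, j). i < j \<and> j < length ns}"
    by (rule finite_subset[of _ "{..length ns} \<times> {..length ns}"]) auto
  from dvd_prodI[OF this, of "(i, j)" "\<lambda>(i, j). int (ns ! j) - int (ns ! i)"] show ?thesis
    using assms unfolding vandermonde_def by simp
qed

lemma distinct_mod:
  assumes "coprime (int m) (vandermonde ns)" "m > 1"
  shows "distinct (map (\<lambda>n. n mod m) ns)"
proof -
  have "ns ! i mod m \<noteq> ns ! j mod m" if "i < j" "j < length ns" for i j
  proof
    assume "ns ! i mod m = ns ! j mod m"
    then have "int m dvd int (ns ! j) - int (ns ! i)"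
      by (metis mod_eq_dvd_iff zmod_int)
    then have "int m dvd vandermonde ns"
      using diff_dvd_vandermonde[OF that] by (rule dvd_trans)
    then show False
      using assms by (metis coprime_common_divisor dvd_refl int_dvd_int_iff nat_dvd_1_iff_1 of_nat_1 less_irrefl)
  qed
  then show ?thesis
    unfolding distinct_conv_nth by (metis length_map linorder_neqE_nat nth_map)
qed

subsection \<open>Partitions and degree sequences\<close>

lemma length_degseq [simp]: "length (degseq lam) = length lam"
  by (simp add: degseq_def)

lemma sorted_degseq:
  assumes "is_partition lam"
  shows "sorted_wrt (<) (degseq lam)"
  unfolding sorted_wrt_iff_nth_less
proof (intro allI impI)
  fix i j assume "i < j" "j < length (degseq lam)"
  then have "lam ! (length lam - 1 - i) \<le> lam ! (length lam - 1 - j)"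
    using assms unfolding is_partition_def sorted_wrt_iff_nth_less by simp
  then show "degseq lam ! i < degseq lam ! j"
    using \<open>i < j\<close> \<open>j < length (degseq lam)\<close> by (simp add: degseq_def)
qed

lemma distinct_degseq: "is_partition lam \<Longrightarrow> distinct (degseq lam)"
  using sorted_degseq strict_sorted_iff by blast

lemma sum_list_degseq: "sum_list (degseq lam) = sum_list lam + (\<Sum>i<length lam. i)"
proof -
  have "sum_list (degseq lam) = (\<Sum>i<length lam. lam ! (length lam - Suc i) + i)"
    by (simp add: degseq_def sum_list_sum_nth lessThan_atLeast0)
  also have "\<dots> = (\<Sum>i<length lam. lam ! i) + (\<Sum>i<length lam. i)"
    by (simp add: sum.distrib sum.nat_diff_reindex[of "\<lambda>i. lam ! i"])
  finally show ?thesis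
    by (simp add: sum_list_sum_nth lessThan_atLeast0)
qed

lemma degseq_inject:
  assumes "degseq a = degseq b"
  shows "a = b"
proof (rule nth_equalityI)
  show len: "length a = length b" using assms by (metis length_degseq)
  fix k assume k: "k < length a"
  then have "degseq a ! (length a - 1 - k) = degseq b ! (length a - 1 - k)"
    using assms by simp
  then show "a ! k = b ! k"
    using k len by (simp add: degseq_def)
qed

lemma ex_partition_degseq:
  assumes "sorted_wrt (<) ts"
  shows "\<exists>mu. is_partition mu \<and> degseq mu = ts"
proof -
  have *: "ts ! i + (j - i) \<le> ts ! j" if "i \<le> j" "j < length ts" for i j
    using that
  proof (induction j rule: dec_induct)
    case (step n)
    moreover have "ts ! n < ts ! Suc n"
      using assms step.prems by (simp add: sorted_wrt_iff_nth_less)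
    ultimately show ?case by simp
  qed simp
  have le: "i \<le> ts ! i" if "i < length ts" for i
    using *[of 0 i] that by simp
  let ?mu = "rev (map (\<lambda>i. ts ! i - i) [0..<length ts])"
  have "is_partition ?mu"
    unfolding is_partition_def sorted_wrt_rev unfolding sorted_wrt_iff_nth_less
  proof (intro allI impI)
    fix i j assume "i < j" "j < length (map (\<lambda>i. ts ! i - i) [0..<length ts])"
    then show "map (\<lambda>i. ts ! i - i) [0..<length ts] ! i \<le> map (\<lambda>i. ts ! i - i) [0..<length ts] ! j"
      using *[of i j] by simp
  qed
  moreover have "degseq ?mu = ts"
    by (rule nth_equalityI) (auto simp: degseq_def rev_nth le)
  ultimately show ?thesis by blast
qed

lemma ex1_partition_set_degseq:
  assumes "finite T"
  shows "\<exists>!mu. is_partition mu \<and> length mu = card T \<and> set (degseq mu) = T"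
proof -
  obtain mu where mu: "is_partition mu" "degseq mu = sorted_list_of_set T"
    using ex_partition_degseq[of "sorted_list_of_set T"] by auto
  show ?thesis
  proof (rule ex1I[of _ mu])
    show "is_partition mu \<and> length mu = card T \<and> set (degseq mu) = T"
      using mu assms length_degseq[of mu] by simp
    fix nu assume nu: "is_partition nu \<and> length nu = card T \<and> set (degseq nu) = T"
    then have "degseq nu = sorted_list_of_set T"
      using sorted_degseq[of nu] by (metis sorted_list_of_set.idem_if_sorted_distinct strict_sorted_iff)
    then show "nu = mu" using mu(2) degseq_inject by metis
  qed
qed

lemma wronskian_degseq:
  assumes "is_partition lam"
  shows "wronskian (map hermite (degseq lam)) = smult (vandermonde (degseq lam)) (hermite_partition lam)"
proof -
  let ?v = "vandermonde (degseq lam)"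
  have "of_int ?v dvd wronskian (map hermite (degseq lam))"
    unfolding wronskian_hermite vandermonde_conv_fun
    by (rule vandermonde_fun_dvd_det)
      (use sorted_degseq[OF assms] in \<open>simp add: sorted_wrt_iff_nth_less\<close>)
  then obtain q where q: "wronskian (map hermite (degseq lam)) = smult ?v q"
    by (auto simp: of_int_poly elim!: dvdE)
  show ?thesis
    unfolding hermite_partition_def q by (rule poly_eqI) (simp add: coeff_map_poly)
qed

theorem mainTheorem5:
  fixes lam :: "nat list" and m :: nat
  assumes "is_partition lam"
    and "odd m" and "m \<ge> 3"
    and "coprime (int m) (vandermonde (degseq lam))"
  shows "(\<forall>i < length lam. \<forall>j < length lam. i \<noteq> j \<longrightarrow>
            degseq lam ! i mod m \<noteq> degseq lam ! j mod m)
       \<and> (\<exists>!mu. is_partition mu \<and> length mu = length lam \<and>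
              set (degseq mu) = (\<lambda>k. k mod m) ` set (degseq lam))
       \<and> (\<forall>mu. is_partition mu \<and> length mu = length lam \<and>
              set (degseq mu) = (\<lambda>k. k mod m) ` set (degseq lam) \<longrightarrow>
              sum_list mu \<le> sum_list lam \<and>
              (\<forall>k. [coeff (hermite_partition lam) k
                    = coeff (monom 1 (sum_list lam - sum_list mu) * hermite_partition mu) k] (mod int m)))"
proof -
  define ns where "ns = degseq lam"
  define ss where "ss = map (\<lambda>k. k mod m) ns"
  have dist: "distinct ss"
    unfolding ss_def ns_def using assms by (intro distinct_mod) auto
  have set_ss: "set ss = (\<lambda>k. k mod m) ` set (degseq lam)"
    by (simp add: ss_def ns_def)
  have len: "length ss = length lam"
    by (simp add: ss_def ns_def)
  have A: "\<forall>i < length lam. \<forall>j < length lam. i \<noteq> j \<longrightarrow>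
      degseq lam ! i mod m \<noteq> degseq lam ! j mod m"
    using dist unfolding distinct_conv_nth by (simp add: ss_def ns_def)
  have B: "\<exists>!mu. is_partition mu \<and> length mu = length lam \<and>
      set (degseq mu) = (\<lambda>k. k mod m) ` set (degseq lam)"
    using ex1_partition_set_degseq[of "set ss"] distinct_card[OF dist] len set_ss by simp
  have C: "sum_list mu \<le> sum_list lam \<and>
      (\<forall>k. [coeff (hermite_partition lam) k
        = coeff (monom 1 (sum_list lam - sum_list mu) * hermite_partition mu) k] (mod int m))"
    if mu: "is_partition mu" "length mu = length lam"
      "set (degseq mu) = (\<lambda>k. k mod m) ` set (degseq lam)" for mu
  proof -
    define q where "q = (\<Sum>n\<leftarrow>ns. m * (n div m))"
    have mset: "mset ss = mset (degseq mu)"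
      using set_eq_iff_mset_eq_distinct[OF dist distinct_degseq[OF mu(1)]] mu(3) set_ss by simp
    have "sum_list ns = q + sum_list ss"
      unfolding q_def ss_def by (simp flip: sum_list_addf)
    also have "sum_list ss = sum_list (degseq mu)"
      using mset by (metis sum_mset_sum_list)
    finally have q: "sum_list lam = sum_list mu + q"
      unfolding ns_def sum_list_degseq by (simp add: mu(2))
    obtain e where e: "vandermonde ss = e * vandermonde (degseq mu)"
      "wronskian (map hermite ss) = of_int e * wronskian (map hermite (degseq mu))"
      using wronskian_vandermonde_permute[OF mset dist] by blast
    define H where "H = monom 1 q * hermite_partition mu"
    have "wronskian (map hermite ss) = smult (vandermonde ss) (hermite_partition mu)"
      unfolding e wronskian_degseq[OF mu(1)] by (simp add: of_int_poly mult.commute)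
    then have "poly_cong m (smult (vandermonde ns) (hermite_partition lam)) (smult (vandermonde ss) H)"
      using wronskian_hermite_mod_cong[OF assms(2), of ns]
      unfolding ss_def[symmetric] q_def[symmetric] H_def
      by (simp add: wronskian_degseq[OF assms(1)] ns_def)
    then have 1: "[vandermonde ns * coeff (hermite_partition lam) k = vandermonde ss * coeff H k] (mod int m)" for k
      unfolding poly_cong_iff coeff_smult by blast
    have 2: "[vandermonde ss * coeff H k = vandermonde ns * coeff H k] (mod int m)" for k
      unfolding ss_def by (intro cong_mult cong_refl cong_sym[OF vandermonde_mod_cong])
    have "coprime (vandermonde ns) (int m)"
      using assms(4) by (simp only: ns_def coprime_commute)
    from cong_mult_lcancel[OF this] have "[coeff (hermite_partition lam) k = coeff H k] (mod int m)" for k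
      using cong_trans[OF 1 2] by blast
    then show ?thesis
      using q by (simp add: H_def)
  qed
  show ?thesis
    by (intro conjI[OF A conjI[OF B]] allI impI, elim conjE, rule C)
qed

end
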